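(* There exist a Cantor fan $X$ and a transitive continuous function $f:X\to X$ such that the inverse limit $\varprojlim(X,f)$ is a Lelek fan. In addition, the shift map on $\varprojlim(X,f)$ is a transitive homeomorphism.
   Context: A continuum is a non-empty compact connected metric space; a subcontinuum is a subspace of a continuum that is itself a continuum. A continuum is a Cantor fan if it is homeomorphic to $\bigcup_{c\in C}A_c\subseteq\mathbb R^2$, where $C\subseteq[0,1]$ is a Cantor set and $A_c$ is the straight line segment from $(0,0)$ to $(c,-1)$. If $Y$ is a subcontinuum of a Cantor fan, a point $x\in Y$ is an end-point of $Y$ if $x$ is an end-point of every arc in $Y$ that contains $x$; $E(Y)$ denotes the set of end-points of $Y$. A subcontinuum $Y$ of a Cantor fan (or a continuum homeomorphic to one) is a Lelek fan if $\mathrm{Cl}(E(Y))=Y$. A continuous map $f:X\to X$ is transitive if for all non-empty open $U,V\subseteq X$ there is a non-negative integer $n$ with $f^n(U)\cap V\neq\emptyset$. The inverse limit is $\varprojlim(X,f)=\{(x_1,x_2,x_3,\ldots)\in\prod_{i=1}^\infty X : x_i=f(x_{i+1})\text{ for each positive integer } i\}$, with the subspace topology of the product, and its shift map is $\sigma(x_1,x_2,x_3,\ldots)=(x_2,x_3,x_4,\ldots)$. *)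

theory Defs
  imports "HOL-Analysis.Analysis"
begin

text \<open>
  Spaces are subsets of a metric type with the subspace topology.  The type
  \<^typ>\<open>nat \<Rightarrow> 'a\<close> is itself a metric space in the library, and its topology is the
  product topology.
\<close>

definition continuum :: "'a::metric_space set \<Rightarrow> bool" where
  "continuum X \<longleftrightarrow> X \<noteq> {} \<and> compact X \<and> connected X"

text \<open>The middle-thirds set: the numbers in $[0,1]$ with a ternary expansion avoiding the digit 1.\<close>

definition ternary_cantor_set :: "real set" where
  "ternary_cantor_set =
     range (\<lambda>a :: nat \<Rightarrow> bool. \<Sum>n. (if a n then 2 else 0) / 3 ^ Suc n)"

definition cantor_set :: "'a::topological_space set \<Rightarrow> bool" where
  "cantor_set C \<longleftrightarrow> C homeomorphic ternary_cantor_set"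

definition planar_fan :: "real set \<Rightarrow> (real \<times> real) set" where
  "planar_fan C = (\<Union>c\<in>C. closed_segment (0, 0) (c, -1))"

definition cantor_fan :: "'a::metric_space set \<Rightarrow> bool" where
  "cantor_fan X \<longleftrightarrow> continuum X \<and>
     (\<exists>C. C \<subseteq> {0..1} \<and> cantor_set C \<and> X homeomorphic planar_fan C)"

text \<open>An arc is given by an injective path; its end-points do not depend on the parametrization.\<close>

definition end_points :: "'a::metric_space set \<Rightarrow> 'a set" where
  "end_points Y = {x \<in> Y. \<forall>g. arc g \<and> path_image g \<subseteq> Y \<and> x \<in> path_image g \<longrightarrow>
                              x = pathstart g \<or> x = pathfinish g}"

text \<open>
  Every Cantor fan is homeomorphic to a planar one, so the Cantor fan \<open>F\<close> below may be
  taken in the plane.  Since \<open>Y\<close> is compact, the ambient closure of \<open>end_points Y\<close> is its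
  closure in \<open>Y\<close>.  A one-point continuum contains no arc, so it is its own set of
  end-points and satisfies the definition; no nondegeneracy is imposed.
\<close>

definition lelek_fan :: "'a::metric_space set \<Rightarrow> bool" where
  "lelek_fan Y \<longleftrightarrow> continuum Y \<and>
     (\<exists>(F :: (real \<times> real) set) Z.
         cantor_fan F \<and> Z \<subseteq> F \<and> continuum Z \<and> Y homeomorphic Z) \<and>
     closure (end_points Y) = Y"

definition transitive_map :: "'a::topological_space set \<Rightarrow> ('a \<Rightarrow> 'a) \<Rightarrow> bool" where
  "transitive_map X f \<longleftrightarrow>
     (\<forall>U V. openin (top_of_set X) U \<and> U \<noteq> {} \<and> openin (top_of_set X) V \<and> V \<noteq> {} \<longrightarrow>
        (\<exists>n::nat. (f ^^ n) ` U \<inter> V \<noteq> {}))"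

text \<open>Coordinates are indexed from 0 instead of 1.\<close>

definition inverse_limit :: "'a set \<Rightarrow> ('a \<Rightarrow> 'a) \<Rightarrow> (nat \<Rightarrow> 'a) set" where
  "inverse_limit X f = {x. (\<forall>i. x i \<in> X) \<and> (\<forall>i. x i = f (x (Suc i)))}"

definition shift_map :: "(nat \<Rightarrow> 'a) \<Rightarrow> nat \<Rightarrow> 'a" where
  "shift_map x = (\<lambda>i. x (Suc i))"

end

theory Submission
  imports Defs
begin

text \<open>
  On the Cantor fan, in the coordinates $(ct, -t)$ with $c$ in the ternary Cantor set and
  $t \in [0,1]$, let \<open>fan_map\<close> shift the ternary expansion of $c$ and change the height $t$ to
  $t/2$ or $\min(1, 3t)$ according to the first digit.  Since the numbers $3^n/2^m$ are dense in
  $(0,\infty)$, a suitable finite word steers any positive height close to any other, whence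
  transitivity, which passes to the inverse limit because the map is onto.

  A point of the inverse limit off the vertex is determined by its digits, including those of its
  past, and by a weighted average of its heights; this embeds the inverse limit in the fan itself.
  A thread whose heights are eventually constantly 1 is the highest one with its digits, so it is an
  end-point.  Every open set contains such a thread: let the past be $\ldots 111$ at height 1 and
  steer from there.
\<close>

subsection \<open>Inverse limits\<close>

lemma inverse_limit_mem: "z \<in> inverse_limit X f \<Longrightarrow> z i \<in> X"
  unfolding inverse_limit_def by blast

lemma inverse_limit_step: "z \<in> inverse_limit X f \<Longrightarrow> f (z (Suc i)) = z i"
  unfolding inverse_limit_def mem_Collect_eq by metis

lemma inverse_limitI:
  assumes "\<And>i. z i \<in> X" "\<And>i. f (z (Suc i)) = z i"
  shows "z \<in> inverse_limit X f"
  unfolding inverse_limit_def using assms by simp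

lemma inverse_limit_funpow:
  assumes "z \<in> inverse_limit X f"
  shows "(f ^^ k) (z (i + k)) = z i"
proof (induction k)
  case (Suc k)
  then show ?case
    using inverse_limit_step[OF assms] by (simp add: funpow_Suc_right del: funpow.simps)
qed simp

lemma funpow_mem:
  assumes "f ` X \<subseteq> X" "x \<in> X"
  shows "(f ^^ k) x \<in> X"
  using assms by (induction k) auto

lemma continuous_on_funpow_self:
  fixes f :: "'a::topological_space \<Rightarrow> 'a"
  assumes "continuous_on X f" "f ` X \<subseteq> X"
  shows "continuous_on X (f ^^ k)"
proof (induction k)
  case (Suc k)
  have "continuous_on X (\<lambda>x. f ((f ^^ k) x))"
    by (rule continuous_on_compose2[OF assms(1) Suc]) (auto intro: funpow_mem[OF assms(2)])
  then show ?case by (simp add: o_def)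
qed simp

lemma continuous_on_coordinate:
  "continuous_on S (\<lambda>z. z i :: 'a::topological_space)"
  by (rule continuous_on_subset[OF continuous_on_product_coordinates subset_UNIV])

text \<open>The coordinates from index \<open>m\<close> on may be any backward orbit; those below
  \<open>m\<close> are then forced to be forward images of its first point.\<close>

lemma inverse_limit_extend:
  assumes fX: "f ` X \<subseteq> X" and p: "\<And>j. p j \<in> X" "\<And>j. f (p (Suc j)) = p j"
  obtains z where "z \<in> inverse_limit X f" "\<And>j. z (m + j) = p j"
proof
  let ?z = "\<lambda>i. if m \<le> i then p (i - m) else (f ^^ (m - i)) (p 0)"
  have "f (?z (Suc i)) = ?z i" for i
  proof (cases "m \<le> i")
    case True
    then show ?thesis using p by (simp add: Suc_diff_le)
  next
    case False
    then obtain d where d: "m = Suc (i + d)" using less_imp_Suc_add[of i m] by auto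
    then show ?thesis by (cases d) auto
  qed
  moreover have "?z i \<in> X" for i
    using p funpow_mem[OF fX p(1)] by auto
  ultimately show "?z \<in> inverse_limit X f" by (intro inverse_limitI)
qed auto

lemma inverse_limit_coordinate_onto:
  assumes "f ` X = X" "x \<in> X"
  obtains z where "z \<in> inverse_limit X f" "z n = x"
proof -
  \<comment> \<open>Iterating a choice of preimages gives a backward orbit of \<open>x\<close>;
    surjectivity keeps the choice inside \<open>X\<close>.\<close>
  let ?p = "\<lambda>j. (inv_into X f ^^ j) x"
  have g: "inv_into X f ` X \<subseteq> X" using assms by (auto simp: inv_into_into)
  have p: "?p j \<in> X" for j by (rule funpow_mem[OF g assms(2)])
  moreover have "f (?p (Suc j)) = ?p j" for j
    using p[of j] assms(1) by (simp add: f_inv_into_f)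
  ultimately obtain z where "z \<in> inverse_limit X f" "\<And>j. z (n + j) = ?p j"
    using inverse_limit_extend[of f X ?p n] assms(1) by auto
  with that[of z] show thesis by (metis add_0_right funpow_0)
qed

text \<open>A basic open set of the product restricts only finitely many coordinates. Up to a bound
  \<open>n\<close> on their indices, all coordinates of a thread are continuous functions of the one
  at \<open>n\<close>, so the restrictions pull back to that single coordinate.\<close>

lemma inverse_limit_basis:
  fixes X :: "'a::topological_space set"
  assumes cont: "continuous_on X f" and fX: "f ` X \<subseteq> X"
    and y: "y \<in> inverse_limit X f" "open U" "y \<in> U"
  obtains n W where "open W" "y n \<in> W" "\<And>z. z \<in> inverse_limit X f \<Longrightarrow> z n \<in> W \<Longrightarrow> z \<in> U"
proof -
  have "openin (product_topology (\<lambda>i::nat. euclidean::'a topology) UNIV) U"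
    using y(2) by (simp add: euclidean_product_topology)
  then obtain V where V: "y \<in> Pi\<^sub>E UNIV V" "\<And>i. open (V i)" "finite {i. V i \<noteq> UNIV}"
      "Pi\<^sub>E UNIV V \<subseteq> U"
    using product_topology_open_contains_basis[of "\<lambda>i::nat. euclidean::'a topology" UNIV U y] y(3)
    by auto
  obtain n where n: "\<And>i. V i \<noteq> UNIV \<Longrightarrow> i \<le> n"
    using V(3) finite_nat_set_iff_bounded_le[of "{i. V i \<noteq> UNIV}"] by auto
  have "\<exists>W. open W \<and> X \<inter> (f ^^ (n - i)) -` V i = X \<inter> W" for i
    using continuous_openin_preimage_gen[OF continuous_on_funpow_self[OF cont fX] V(2)]
    by (metis openin_open)
  then obtain W where W: "\<And>i. open (W i)" "\<And>i. X \<inter> (f ^^ (n - i)) -` V i = X \<inter> W i"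
    by metis
  have pow: "z i = (f ^^ (n - i)) (z n)" if "z \<in> inverse_limit X f" "i \<le> n" for z i
    using inverse_limit_funpow[OF that(1), of "n - i" i] that(2) by simp
  show thesis
  proof
    show "open (\<Inter>i\<le>n. W i)" using W(1) by (intro open_INT) auto
    show "y n \<in> (\<Inter>i\<le>n. W i)"
    proof
      fix i assume "i \<in> {..n}"
      moreover have "y n \<in> X" using y(1) by (rule inverse_limit_mem)
      moreover have "y i \<in> V i" using V(1) by auto
      ultimately have "y n \<in> X \<inter> (f ^^ (n - i)) -` V i" using pow[OF y(1), of i] by simp
      then show "y n \<in> W i" unfolding W(2) by blast
    qed
    fix z assume z: "z \<in> inverse_limit X f" "z n \<in> (\<Inter>i\<le>n. W i)"
    have "z i \<in> V i" for i
    proof (cases "i \<le> n")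
      case True
      have "z n \<in> X \<inter> W i" using z True inverse_limit_mem[OF z(1)] by auto
      then show ?thesis using W(2)[of i] pow[OF z(1) True] by auto
    next
      case False
      then have "V i = UNIV" using n by blast
      then show ?thesis by simp
    qed
    then show "z \<in> U" using V(4) by (auto simp: PiE_iff)
  qed
qed

section \<open>Compactness and connectedness of inverse limits\<close>

lemma compact_PiE_UNIV:
  fixes X :: "'i \<Rightarrow> 'a::topological_space set"
  assumes "\<And>i. compact (X i)"
  shows "compact (Pi\<^sub>E UNIV X)"
  using assms compactin_PiE[of "\<lambda>i. euclidean" UNIV X]
  by (simp add: euclidean_product_topology)

lemma compact_inverse_limit:
  fixes X :: "'a::metric_space set"
  assumes "compact X" "continuous_on X f"
  shows "compact (inverse_limit X f)"
proof -
  let ?Q = "Pi\<^sub>E UNIV (\<lambda>i::nat. X)"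
  have Q: "compact ?Q" by (rule compact_PiE_UNIV) (rule assms)
  \<comment> \<open>Written as the vanishing of a real function continuous on \<open>?Q\<close>,
    each thread equation cuts out a closed set.\<close>
  have "closed {x \<in> ?Q. dist (x i) (f (x (Suc i))) = 0}" for i
  proof (rule continuous_closed_preimage_constant)
    have "continuous_on ?Q (\<lambda>x. f (x (Suc i)))"
      by (rule continuous_on_compose2[OF assms(2) continuous_on_coordinate]) auto
    then show "continuous_on ?Q (\<lambda>x. dist (x i) (f (x (Suc i))))"
      by (intro continuous_intros continuous_on_coordinate)
  qed (use Q compact_imp_closed in blast)
  then have "compact (?Q \<inter> (\<Inter>i. {x \<in> ?Q. dist (x i) (f (x (Suc i))) = 0}))"
    by (intro compact_Int_closed[OF Q] closed_INT) auto
  also have "?Q \<inter> (\<Inter>i. {x \<in> ?Q. dist (x i) (f (x (Suc i))) = 0}) = inverse_limit X f"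
    unfolding inverse_limit_def PiE_UNIV_domain by (simp add: set_eq_iff) blast
  finally show ?thesis .
qed

text \<open>A separation of the limit is, by compactness, already visible in a single coordinate.\<close>

lemma connected_inverse_limit:
  fixes X :: "'a::metric_space set"
  assumes X: "compact X" "connected X" and cont: "continuous_on X f" and onto: "f ` X = X"
  shows "connected (inverse_limit X f)"
proof (rule connectedI)
  let ?Y = "inverse_limit X f"
  fix A B :: "(nat \<Rightarrow> 'a) set"
  assume A: "open A" and B: "open B" and AY: "A \<inter> ?Y \<noteq> {}" and BY: "B \<inter> ?Y \<noteq> {}"
    and cover: "?Y \<subseteq> A \<union> B" and disj: "A \<inter> B \<inter> ?Y = {}"
  have cY: "compact ?Y" using X(1) cont by (rule compact_inverse_limit)
  have eqA: "?Y \<inter> A = ?Y - B" and eqB: "?Y \<inter> B = ?Y - A" using cover disj by blast+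
  have cA: "compact (?Y \<inter> A)" and cB: "compact (?Y \<inter> B)"
    unfolding eqA eqB using cY A B by (auto intro: compact_diff)
  \<comment> \<open>\<open>G n\<close> is the largest open set such that every thread whose
    coordinate \<open>n\<close> lies in it belongs to \<open>A\<close>.\<close>
  define G where "G n = \<Union>{W. open W \<and> (\<forall>z\<in>?Y. z n \<in> W \<longrightarrow> z \<in> A)}" for n
  have openG: "open {z. z n \<in> G n}" for n :: nat
  proof -
    have "open (G n)" unfolding G_def by (rule open_Union) auto
    then have "open ((\<lambda>z. z n) -` G n)"
      by (rule open_vimage) simp
    then show ?thesis by (simp add: vimage_def)
  qed
  have "\<exists>n. y n \<in> G n" if "y \<in> ?Y \<inter> A" for y
  proof -
    have fX: "f ` X \<subseteq> X" and y: "y \<in> ?Y" "y \<in> A" using onto that by auto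
    obtain n W where "open W" "y n \<in> W" "\<And>z. z \<in> ?Y \<Longrightarrow> z n \<in> W \<Longrightarrow> z \<in> A"
      using inverse_limit_basis[OF cont fX y(1) A y(2)] by metis
    then have "y n \<in> G n" unfolding G_def by blast
    then show ?thesis ..
  qed
  then have subG: "?Y \<inter> A \<subseteq> (\<Union>n. {z. z n \<in> G n})" by auto
  obtain N where N: "finite N" "?Y \<inter> A \<subseteq> (\<Union>n\<in>N. {z. z n \<in> G n})"
    by (rule compactE_image[OF cA openG subG])
  obtain n where n: "\<And>i. i \<in> N \<Longrightarrow> i \<le> n"
    using N(1) by (auto simp: finite_nat_set_iff_bounded_le)
  \<comment> \<open>With \<open>n\<close> above the finitely many indices, membership of a thread in
    \<open>A\<close> depends on its coordinate \<open>n\<close> alone. Hence the projections of the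
    two pieces are disjoint; they are also closed, and by surjectivity they cover
    \<open>X\<close>.\<close>
  have sep: "z' \<in> A" if z: "z \<in> ?Y" "z \<in> A" "z' \<in> ?Y" "z n = z' n" for z z'
  proof -
    obtain i where i: "i \<in> N" "z i \<in> G i" using N(2) z by auto
    have "(f ^^ (n - i)) (z n) = z i" "(f ^^ (n - i)) (z' n) = z' i"
      using inverse_limit_funpow[OF z(1), of "n - i" i] inverse_limit_funpow[OF z(3), of "n - i" i] n[OF i(1)]
      by auto
    then have "z' i \<in> G i" using z(4) i(2) by simp
    then show ?thesis using z(3) unfolding G_def by auto
  qed
  have mem: "z n \<in> X" if "z \<in> ?Y" for z using that by (rule inverse_limit_mem)
  let ?\<pi> = "\<lambda>z :: nat \<Rightarrow> 'a. z n"
  have "compact (?\<pi> ` (?Y \<inter> A))" "compact (?\<pi> ` (?Y \<inter> B))"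
    using cA cB by (auto intro!: compact_continuous_image continuous_on_coordinate)
  then have "closed (?\<pi> ` (?Y \<inter> A))" "closed (?\<pi> ` (?Y \<inter> B))"
    using compact_imp_closed by auto
  moreover have "X \<subseteq> ?\<pi> ` (?Y \<inter> A) \<union> ?\<pi> ` (?Y \<inter> B)"
  proof
    fix x assume "x \<in> X"
    then obtain z where "z \<in> ?Y" "z n = x" using inverse_limit_coordinate_onto[OF onto] by metis
    then show "x \<in> ?\<pi> ` (?Y \<inter> A) \<union> ?\<pi> ` (?Y \<inter> B)" using cover by blast
  qed
  moreover have "?\<pi> ` (?Y \<inter> A) \<inter> ?\<pi> ` (?Y \<inter> B) \<inter> X = {}"
    using sep disj by blast
  moreover have "?\<pi> ` (?Y \<inter> A) \<inter> X \<noteq> {}" "?\<pi> ` (?Y \<inter> B) \<inter> X \<noteq> {}"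
    using AY BY mem by auto
  ultimately show False using connected_closedD[OF X(2)] by blast
qed

lemma continuum_inverse_limit:
  fixes X :: "'a::metric_space set"
  assumes X: "continuum X" and cont: "continuous_on X f" and onto: "f ` X = X"
  shows "continuum (inverse_limit X f)"
proof -
  obtain x where "x \<in> X" using X unfolding continuum_def by auto
  then have "inverse_limit X f \<noteq> {}" using inverse_limit_coordinate_onto[OF onto] by (metis empty_iff)
  then show ?thesis
    using X compact_inverse_limit[OF _ cont] connected_inverse_limit[OF _ _ cont onto]
    unfolding continuum_def by blast
qed

section \<open>The shift map\<close>

text \<open>Applying \<open>f\<close> to every coordinate of a thread (x_0, x_1, ...) yields
  (f(x_0), x_0, x_1, ...), which undoes the shift.\<close>

lemma homeomorphism_shift_map:
  fixes X :: "'a::topological_space set"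
  assumes cont: "continuous_on X f" and fX: "f ` X \<subseteq> X"
  shows "homeomorphism (inverse_limit X f) (inverse_limit X f) shift_map (\<lambda>x i. f (x i))"
proof -
  let ?Y = "inverse_limit X f"
  have mem: "z i \<in> X" "f (z i) \<in> X" if "z \<in> ?Y" for z i
    using inverse_limit_mem[OF that, of i] fX by blast+
  show ?thesis
  proof (rule homeomorphismI)
    show "continuous_on ?Y shift_map"
      unfolding shift_map_def by (intro continuous_intros continuous_on_coordinate)
    show "continuous_on ?Y (\<lambda>x i. f (x i))"
      by (intro continuous_intros continuous_on_compose2[OF cont continuous_on_coordinate])
        (auto simp: mem)
  qed (auto simp: shift_map_def inverse_limit_step mem intro!: inverse_limitI)
qed

text \<open>The shift inverts the coordinatewise action of \<open>f\<close>, so the roles are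
  exchanged: an orbit segment of \<open>f\<close> from \<open>W2\<close> to \<open>W1\<close>
  becomes one of the shift from \<open>U\<close> to \<open>V\<close>.\<close>

lemma transitive_shift_map:
  fixes X :: "'a::topological_space set"
  assumes cont: "continuous_on X f" and onto: "f ` X = X" and trans: "transitive_map X f"
  shows "transitive_map (inverse_limit X f) shift_map"
  unfolding transitive_map_def
proof (intro allI impI, elim conjE)
  let ?Y = "inverse_limit X f"
  fix U V assume U: "openin (top_of_set ?Y) U" "U \<noteq> {}" and V: "openin (top_of_set ?Y) V" "V \<noteq> {}"
  have fX: "f ` X \<subseteq> X" using onto by simp
  \<comment> \<open>Every sufficiently large index works, so \<open>U\<close> and \<open>V\<close>
    can both be treated at one common coordinate.\<close>
  have basis: "\<exists>n0. \<forall>n\<ge>n0. \<exists>W. openin (top_of_set X) W \<and> W \<noteq> {} \<and> (\<forall>z\<in>?Y. z n \<in> W \<longrightarrow> z \<in> U)"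
    if "openin (top_of_set ?Y) U" "U \<noteq> {}" for U
  proof -
    obtain T where T: "open T" "U = ?Y \<inter> T" using \<open>openin (top_of_set ?Y) U\<close> by (auto simp: openin_open)
    obtain y where "y \<in> U" using \<open>U \<noteq> {}\<close> by blast
    with T(2) have y: "y \<in> ?Y" "y \<in> T" by auto
    obtain n0 W where W: "open W" "y n0 \<in> W" "\<And>z. z \<in> ?Y \<Longrightarrow> z n0 \<in> W \<Longrightarrow> z \<in> T"
      using inverse_limit_basis[OF cont fX y(1) T(1) y(2)] by metis
    have "\<exists>W. openin (top_of_set X) W \<and> W \<noteq> {} \<and> (\<forall>z\<in>?Y. z n \<in> W \<longrightarrow> z \<in> U)" if "n \<ge> n0" for n
    proof (intro exI conjI ballI impI)
      let ?W = "X \<inter> (f ^^ (n - n0)) -` W"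
      have pow: "(f ^^ (n - n0)) (z n) = z n0" if "z \<in> ?Y" for z
        using inverse_limit_funpow[OF that, of "n - n0" n0] \<open>n \<ge> n0\<close> by simp
      show "openin (top_of_set X) ?W"
        using continuous_openin_preimage_gen[OF continuous_on_funpow_self[OF cont fX] W(1)] .
      have "y n \<in> ?W" using W(2) pow[OF y(1)] inverse_limit_mem[OF y(1)] by auto
      then show "?W \<noteq> {}" by blast
      show "z \<in> U" if "z \<in> ?Y" "z n \<in> ?W" for z
        using T(2) W(3) that pow[of z] by auto
    qed
    then show ?thesis by blast
  qed
  obtain n1 where n1: "\<forall>n\<ge>n1. \<exists>W. openin (top_of_set X) W \<and> W \<noteq> {} \<and> (\<forall>z\<in>?Y. z n \<in> W \<longrightarrow> z \<in> U)"
    using basis[OF U] by blast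
  obtain n2 where n2: "\<forall>n\<ge>n2. \<exists>W. openin (top_of_set X) W \<and> W \<noteq> {} \<and> (\<forall>z\<in>?Y. z n \<in> W \<longrightarrow> z \<in> V)"
    using basis[OF V] by blast
  define n where "n = max n1 n2"
  obtain W1 where W1: "openin (top_of_set X) W1" "W1 \<noteq> {}" "\<forall>z\<in>?Y. z n \<in> W1 \<longrightarrow> z \<in> U"
    using n1 unfolding n_def by (meson max.cobounded1)
  obtain W2 where W2: "openin (top_of_set X) W2" "W2 \<noteq> {}" "\<forall>z\<in>?Y. z n \<in> W2 \<longrightarrow> z \<in> V"
    using n2 unfolding n_def by (meson max.cobounded2)
  obtain k x where k: "x \<in> W2" "(f ^^ k) x \<in> W1"
    using trans[unfolded transitive_map_def, rule_format, of W2 W1] W1(1,2) W2(1,2) by auto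
  have "x \<in> X" using k(1) openin_imp_subset[OF W2(1)] by blast
  then obtain z where z: "z \<in> ?Y" "z n = x" using inverse_limit_coordinate_onto[OF onto] by metis
  define y where "y i = (f ^^ k) (z i)" for i
  have "y \<in> ?Y"
  proof (rule inverse_limitI)
    show "y i \<in> X" for i
      unfolding y_def by (rule funpow_mem[OF fX inverse_limit_mem[OF z(1)]])
    show "f (y (Suc i)) = y i" for i
      using inverse_limit_step[OF z(1)] by (simp add: y_def funpow_swap1)
  qed
  then have "y \<in> U" using W1(3) k(2) z(2) by (simp add: y_def)
  have "(shift_map ^^ j) y i = y (i + j)" for i j
    by (induction j arbitrary: i) (auto simp: shift_map_def)
  then have "(shift_map ^^ k) y = z"
    using inverse_limit_funpow[OF z(1), of k] by (auto simp: y_def fun_eq_iff)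
  moreover have "z \<in> V" using W2(3) z k(1) by simp
  ultimately show "\<exists>n. (shift_map ^^ n) ` U \<inter> V \<noteq> {}" using \<open>y \<in> U\<close> by blast
qed

subsection \<open>The ternary Cantor set\<close>

definition cantor_sum :: "(nat \<Rightarrow> bool) \<Rightarrow> real" where
  "cantor_sum b = (\<Sum>n. (if b n then 2 else 0) / 3 ^ Suc n)"

lemma range_cantor_sum: "range cantor_sum = ternary_cantor_set"
  by (simp add: ternary_cantor_set_def cantor_sum_def[abs_def])

lemma summable_cantor_sum: "summable (\<lambda>n. (if b n then 2 else 0) / 3 ^ Suc n :: real)"
proof (rule summable_comparison_test')
  show "summable (\<lambda>n. 2 / 3 * (1 / 3) ^ n :: real)"
    by (intro summable_mult summable_geometric) simp
qed (simp add: power_divide)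

lemma cantor_sum_shift: "cantor_sum b = ((if b 0 then 2 else 0) + cantor_sum (\<lambda>n. b (Suc n))) / 3"
proof -
  let ?g = "\<lambda>n. (if b (Suc n) then 2 else 0) / 3 ^ Suc n :: real"
  have "cantor_sum b = (\<Sum>n. ?g n / 3) + (if b 0 then 2 else 0) / 3"
    unfolding cantor_sum_def using suminf_split_head[OF summable_cantor_sum, of b] by simp
  also have "(\<Sum>n. ?g n / 3) = cantor_sum (\<lambda>n. b (Suc n)) / 3"
    unfolding cantor_sum_def by (rule suminf_divide[OF summable_cantor_sum])
  finally show ?thesis by (simp add: add_divide_distrib)
qed

lemma cantor_sum_bounds: "0 \<le> cantor_sum b" "cantor_sum b \<le> 1"
proof -
  show "0 \<le> cantor_sum b"
    unfolding cantor_sum_def by (intro suminf_nonneg summable_cantor_sum) auto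
  have s: "(\<lambda>n. 2 / 3 * (1 / 3) ^ n :: real) sums (2 / 3 * (1 / (1 - 1 / 3)))"
    by (intro sums_mult geometric_sums) simp
  have "cantor_sum b \<le> (\<Sum>n. 2 / 3 * (1 / 3) ^ n)"
    unfolding cantor_sum_def
    by (intro suminf_le summable_cantor_sum sums_summable[OF s]) (auto simp: power_divide)
  also have "\<dots> = 1" using sums_unique[OF s] by simp
  finally show "cantor_sum b \<le> 1" .
qed

lemma cantor_sum_digit:
  shows "b 0 \<Longrightarrow> cantor_sum b \<ge> 2 / 3"
    and "\<not> b 0 \<Longrightarrow> cantor_sum b \<le> 1 / 3"
  using cantor_sum_bounds[of "\<lambda>n. b (Suc n)"] by (subst cantor_sum_shift; simp)+

text \<open>Any two values differ by at most 1, and each common leading digit divides the difference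
  by 3.\<close>

lemma cantor_sum_close:
  assumes "\<And>n. n < N \<Longrightarrow> b n = b' n"
  shows "\<bar>cantor_sum b - cantor_sum b'\<bar> \<le> 1 / 3 ^ N"
  using assms
proof (induction N arbitrary: b b')
  case 0
  show ?case using cantor_sum_bounds[of b] cantor_sum_bounds[of b'] by auto
next
  case (Suc N)
  have "\<bar>cantor_sum (\<lambda>n. b (Suc n)) - cantor_sum (\<lambda>n. b' (Suc n))\<bar> \<le> 1 / 3 ^ N"
    using Suc.prems by (intro Suc.IH) auto
  moreover have "b 0 = b' 0" using Suc.prems by simp
  moreover have "cantor_sum b - cantor_sum b'
      = (cantor_sum (\<lambda>n. b (Suc n)) - cantor_sum (\<lambda>n. b' (Suc n))) / 3"
    using cantor_sum_shift[of b] cantor_sum_shift[of b'] \<open>b 0 = b' 0\<close> by (simp add: field_simps)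
  ultimately show ?case by simp
qed

text \<open>The gap between 1/3 and 2/3 reveals the first digit; the tail then reveals the others by
  induction.\<close>

lemma cantor_sum_inj:
  assumes "cantor_sum b = cantor_sum b'"
  shows "b n = b' n"
  using assms
proof (induction n arbitrary: b b')
  case 0
  then show ?case using cantor_sum_digit[of b] cantor_sum_digit[of b'] by linarith
next
  case (Suc n)
  have "b 0 = b' 0" using Suc.prems cantor_sum_digit[of b] cantor_sum_digit[of b'] by linarith
  with Suc.prems have "cantor_sum (\<lambda>n. b (Suc n)) = cantor_sum (\<lambda>n. b' (Suc n))"
    by (subst (asm) (1 2) cantor_sum_shift) simp
  from Suc.IH[OF this] show ?case .
qed

lemma continuous_on_suminf_bounded:
  fixes g :: "nat \<Rightarrow> 'a::topological_space \<Rightarrow> real"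
  assumes "\<And>n. continuous_on S (g n)" "\<And>n x. x \<in> S \<Longrightarrow> \<bar>g n x\<bar> \<le> M n" "summable M"
  shows "continuous_on S (\<lambda>x. \<Sum>n. g n x)"
proof (rule uniform_limit_theorem)
  show "uniform_limit S (\<lambda>n x. \<Sum>i<n. g i x) (\<lambda>x. \<Sum>n. g n x) sequentially"
    using assms(2,3) by (intro Weierstrass_m_test) auto
  show "\<forall>\<^sub>F n in sequentially. continuous_on S (\<lambda>x. \<Sum>i<n. g i x)"
    by (intro always_eventually allI continuous_intros assms(1))
qed simp

text \<open>The space of digit sequences is compact by Tychonoff, and the ternary value is
  continuous on it by the Weierstrass test.\<close>

lemma compact_ternary_cantor_set: "compact ternary_cantor_set"
proof -
  have "compact (UNIV :: (nat \<Rightarrow> bool) set)"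
    using compactin_PiE[of "\<lambda>i::nat. euclidean" UNIV "\<lambda>i. UNIV :: bool set"]
    by (simp add: euclidean_product_topology finite_imp_compact)
  moreover have "continuous_on UNIV cantor_sum"
    unfolding cantor_sum_def[abs_def]
  proof (rule continuous_on_suminf_bounded)
    fix n :: nat
    have "continuous_on UNIV ((\<lambda>v. (if v then 2 else 0) / 3 ^ Suc n :: real) \<circ> (\<lambda>b :: nat \<Rightarrow> bool. b n))"
      by (intro continuous_on_compose continuous_on_product_coordinates)
         (auto simp: continuous_on_discrete)
    then show "continuous_on UNIV (\<lambda>b :: nat \<Rightarrow> bool. (if b n then 2 else 0) / 3 ^ Suc n :: real)"
      by (simp add: o_def)
  next
    show "summable (\<lambda>n. 2 / 3 ^ Suc n :: real)"
      using summable_cantor_sum[of "\<lambda>n. True"] by simp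
  qed (auto simp: abs_if)
  ultimately show ?thesis
    unfolding range_cantor_sum[symmetric] by (intro compact_continuous_image)
qed

subsection \<open>A transitive map on the Cantor fan\<close>

definition fan :: "(real \<times> real) set" where
  "fan = planar_fan ternary_cantor_set"

text \<open>Digits and height serve as coordinates on the fan. They are unique except at the vertex,
  where every digit sequence goes with height 0.\<close>

definition fan_point :: "(nat \<Rightarrow> bool) \<Rightarrow> real \<Rightarrow> real \<times> real" where
  "fan_point b t = (cantor_sum b * t, - t)"

abbreviation height :: "real \<times> real \<Rightarrow> real" where
  "height p \<equiv> - snd p"

text \<open>The vertex has no first digit; the value there is \<open>False\<close>.\<close>

definition digit :: "real \<times> real \<Rightarrow> bool" where
  "digit p \<longleftrightarrow> 2 * fst p + snd p > 0"

definition height_map :: "bool \<Rightarrow> real \<Rightarrow> real" where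
  "height_map a t = (if a then min 1 (3 * t) else t / 2)"

text \<open>
  The form \<open>2 * fst p + snd p\<close> is $(2c-1)t$, so its sign tells the first digit of $c$.
  With $m = \max(1/3, t)$ we have $t/m = \min(1,3t)$, and no case distinction is needed at $t = 0$.
\<close>

definition fan_map :: "real \<times> real \<Rightarrow> real \<times> real" where
  "fan_map p = (if 2 * fst p + snd p \<le> 0 then (3 / 2 * fst p, snd p / 2)
     else ((3 * fst p + 2 * snd p) / max (1 / 3) (- snd p), snd p / max (1 / 3) (- snd p)))"

lemma fan_point_mem: "0 \<le> t \<Longrightarrow> t \<le> 1 \<Longrightarrow> fan_point b t \<in> fan"
  unfolding fan_def planar_fan_def fan_point_def range_cantor_sum[symmetric]
  by (force simp: closed_segment_def)

lemma fanE:
  assumes "p \<in> fan"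
  obtains b t where "0 \<le> t" "t \<le> 1" "p = fan_point b t"
  using assms unfolding fan_def planar_fan_def fan_point_def range_cantor_sum[symmetric]
  by (force simp: closed_segment_def)

lemma height_fan_point [simp]: "height (fan_point b t) = t" "snd (fan_point b t) = - t"
  by (simp_all add: fan_point_def)

lemma height_fan:
  assumes "p \<in> fan"
  shows "0 \<le> height p" "height p \<le> 1"
  using assms by (auto elim!: fanE)

lemma fan_point_0 [simp]: "fan_point b 0 = (0, 0)"
  by (simp add: fan_point_def)

lemma digit_form_fan_point:
  assumes "t > 0"
  shows "b 0 \<Longrightarrow> 2 * fst (fan_point b t) + snd (fan_point b t) > 0"
    and "\<not> b 0 \<Longrightarrow> 2 * fst (fan_point b t) + snd (fan_point b t) < 0"
proof -
  have eq: "2 * fst (fan_point b t) + snd (fan_point b t) = (2 * cantor_sum b - 1) * t"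
    by (simp add: fan_point_def algebra_simps)
  show "2 * fst (fan_point b t) + snd (fan_point b t) > 0" if "b 0"
    unfolding eq using cantor_sum_digit(1)[of b] that assms by (intro mult_pos_pos) auto
  show "2 * fst (fan_point b t) + snd (fan_point b t) < 0" if "\<not> b 0"
    unfolding eq using cantor_sum_digit(2)[of b] that assms by (intro mult_neg_pos) auto
qed

lemma digit_fan_point [simp]: "t > 0 \<Longrightarrow> digit (fan_point b t) = b 0"
  unfolding digit_def using digit_form_fan_point[of t b] by fastforce

text \<open>Since 1/2 lies in the removed middle third, the factor $2c-1$ is never 0. Thus
  definitions by cases on the sign need to agree only at the vertex to be continuous.\<close>

lemma digit_form_eq_0:
  assumes "p \<in> fan" "2 * fst p + snd p = 0"
  shows "height p = 0"
proof -
  obtain b t where bt: "0 \<le> t" "p = fan_point b t" using assms(1) by (auto elim: fanE)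
  then have "\<not> t > 0" using digit_form_fan_point[of t b] assms(2) by fastforce
  then show ?thesis using bt by simp
qed

lemma height_fan_map:
  assumes "0 \<le> height p"
  shows "height (fan_map p) = height_map (digit p) (height p)"
  using assms by (auto simp: fan_map_def height_map_def digit_def field_simps max_def min_def)

text \<open>Dropping the first digit takes $c$ to $3c-2$ or $3c$; multiplied by the new height, this
  is the first component of \<open>fan_map\<close>.\<close>

lemma fan_map_fan_point:
  assumes "0 \<le> t"
  shows "fan_map (fan_point b t) = fan_point (\<lambda>n. b (Suc n)) (height_map (b 0) t)"
proof (cases "t = 0")
  case True
  then show ?thesis by (simp add: fan_map_def height_map_def)
next
  case False
  with assms have t: "t > 0" by simp
  have snd: "snd (fan_map (fan_point b t)) = - height_map (b 0) t"
    using height_fan_map[of "fan_point b t"] t by simp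
  have "fst (fan_map (fan_point b t)) = cantor_sum (\<lambda>n. b (Suc n)) * height_map (b 0) t"
  proof (cases "b 0")
    case True
    then have c: "3 * cantor_sum b = 2 + cantor_sum (\<lambda>n. b (Suc n))"
      by (subst cantor_sum_shift) simp
    have "fst (fan_map (fan_point b t)) = (3 * cantor_sum b - 2) * (t / max (1 / 3) t)"
      using digit_form_fan_point(1)[of t b] True t by (simp add: fan_map_def fan_point_def left_diff_distrib)
    also have "t / max (1 / 3) t = min 1 (3 * t)" using t by (auto simp: max_def min_def)
    finally show ?thesis using True c by (simp add: height_map_def)
  next
    case False
    then have "3 * cantor_sum b = cantor_sum (\<lambda>n. b (Suc n))"
      by (subst cantor_sum_shift) simp
    then show ?thesis
      using digit_form_fan_point(2)[of t b] False t
      by (simp add: fan_map_def fan_point_def height_map_def)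
  qed
  with snd show ?thesis by (simp add: fan_point_def prod_eq_iff)
qed

lemma height_map_bounds:
  assumes "0 \<le> t" "t \<le> 1"
  shows "0 \<le> height_map a t" "height_map a t \<le> 1" "t > 0 \<Longrightarrow> height_map a t > 0"
  using assms by (auto simp: height_map_def)

lemma fan_map_image: "fan_map ` fan = fan"
proof
  show "fan_map ` fan \<subseteq> fan"
    by (auto elim!: fanE simp: fan_map_fan_point height_map_bounds fan_point_mem)
  show "fan \<subseteq> fan_map ` fan"
  proof
    fix p assume "p \<in> fan"
    then obtain b t where bt: "0 \<le> t" "t \<le> 1" "p = fan_point b t" by (rule fanE)
    \<comment> \<open>The new digit is \<open>True\<close> because \<open>t / 3\<close> is always an
      admissible height; \<open>False\<close> would require \<open>2 * t\<close>, which may exceed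
      1.\<close>
    then have "p = fan_map (fan_point (case_nat True b) (t / 3))"
      by (simp add: fan_map_fan_point height_map_def)
    then show "p \<in> fan_map ` fan" using bt by (auto intro!: fan_point_mem)
  qed
qed

lemma continuous_on_fan_map: "continuous_on fan fan_map"
  unfolding fan_map_def[abs_def]
proof (rule continuous_on_cases_le)
  fix p assume "p \<in> fan" "2 * fst p + snd p = 0"
  with digit_form_eq_0[of p] have "p = (0, 0)" by (simp add: prod_eq_iff)
  then show "(3 / 2 * fst p, snd p / 2) =
      ((3 * fst p + 2 * snd p) / max (1 / 3) (- snd p), snd p / max (1 / 3) (- snd p))"
    by simp
next
  have m: "max (1 / 3) (- x) \<noteq> 0" for x :: real by (simp add: max_def)
  show "continuous_on {p \<in> fan. 0 \<le> 2 * fst p + snd p}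
      (\<lambda>p. ((3 * fst p + 2 * snd p) / max (1 / 3) (- snd p), snd p / max (1 / 3) (- snd p)))"
    by (intro continuous_intros ballI m)
qed (intro continuous_intros; simp)+

lemma fan_alt: "fan = (\<lambda>(c, t). (c * t, - t)) ` (ternary_cantor_set \<times> {0..1})"
proof (intro equalityI subsetI)
  fix p assume "p \<in> fan"
  then obtain b t where "0 \<le> t" "t \<le> 1" "p = fan_point b t" by (rule fanE)
  then show "p \<in> (\<lambda>(c, t). (c * t, - t)) ` (ternary_cantor_set \<times> {0..1})"
    unfolding range_cantor_sum[symmetric] fan_point_def by force
next
  fix p :: "real \<times> real" assume "p \<in> (\<lambda>(c, t). (c * t, - t)) ` (ternary_cantor_set \<times> {0..1})"
  then obtain c t where "c \<in> ternary_cantor_set" "0 \<le> t" "t \<le> 1" "p = (c * t, - t)" by auto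
  then obtain b where "0 \<le> t" "t \<le> 1" "p = fan_point b t"
    unfolding range_cantor_sum[symmetric] fan_point_def by auto
  then show "p \<in> fan" using fan_point_mem by simp
qed

lemma continuum_fan: "continuum fan"
  unfolding continuum_def
proof (intro conjI)
  show "fan \<noteq> {}" using fan_point_mem[of 0] by auto
  show "compact fan"
    unfolding fan_alt split_def
    by (intro compact_continuous_image continuous_intros compact_Times compact_ternary_cantor_set) simp
  show "connected fan"
    unfolding fan_def planar_fan_def by (rule connected_Union) (auto simp: zero_prod_def[symmetric])
qed

lemma cantor_fan_fan: "cantor_fan fan"
  unfolding cantor_fan_def
proof (intro conjI exI)
  show "continuum fan" by (rule continuum_fan)
  show "ternary_cantor_set \<subseteq> {0..1}"
    using cantor_sum_bounds by (auto simp: range_cantor_sum[symmetric])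
  show "cantor_set ternary_cantor_set" by (simp add: cantor_set_def homeomorphic_refl)
  show "fan homeomorphic planar_fan ternary_cantor_set" by (simp add: fan_def homeomorphic_refl)
qed

text \<open>
  Dirichlet approximation of $\log_2 3$ yields a ratio $3^q/2^p$ close to 1, and different from 1
  by parity; its powers form a fine enough mesh.
\<close>

lemma powers_3_2_dense:
  fixes t a b :: real
  assumes t: "0 < t" and ab: "0 < a" "a < b"
  obtains m n :: nat where "a < 3 ^ n * t / 2 ^ m" "3 ^ n * t / 2 ^ m < b"
proof -
  have "0 < log 2 (b / a)" using ab by simp
  \<comment> \<open>This choice makes a single multiplication by the later \<open>r\<close> too
    small to jump across the interval from \<open>a\<close> to \<open>b\<close>.\<close>
  then obtain N :: nat where N: "N > 0" "1 / N < log 2 (b / a)"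
    by (metis inverse_eq_divide real_arch_inverse gr_zeroI)
  obtain h k where hk: "0 < k" "\<bar>of_int k * log 2 3 - of_int h\<bar> < 1 / N"
    using Dirichlet_approx[OF N(1), of "log 2 3"] by metis
  \<comment> \<open>Positivity of \<open>h\<close> is needed for \<open>nat h\<close> to keep its
    value and for \<open>2 ^ p\<close> to be even. It holds because \<open>k\<close> times the
    logarithm exceeds 1, while the approximation error is below 1.\<close>
  have l3: "1 < log 2 (3::real)" by (subst less_log_iff) auto
  have "1 \<le> real_of_int k" using hk(1) by linarith
  from mult_right_mono[OF this, of "log 2 3"] l3 have "1 < of_int k * log 2 (3::real)" by linarith
  moreover have "1 / real N \<le> 1" using N(1) by simp
  ultimately have "0 < real_of_int h" using hk(2) by linarith
  then have h: "0 < h" by simp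
  define q p where "q = nat k" and "p = nat h"
  define r :: real where "r = 3 ^ q / 2 ^ p"
  have r0: "r > 0" by (simp add: r_def)
  have "log 2 r = of_int k * log 2 3 - of_int h"
    using hk(1) h by (simp add: r_def log_divide log_nat_power q_def p_def)
  then have lr: "log 2 r < log 2 (b / a)" "- log 2 (b / a) < log 2 r"
    using hk(2) N(2) by linarith+
  have r1: "r < b / a" using lr(1) r0 ab by simp
  have "log 2 (a / b) = - log 2 (b / a)" using ab by (simp add: log_divide)
  with lr(2) have r2: "a / b < r"
    using r0 ab by (metis divide_pos_pos log_less_cancel_iff order_less_trans
      one_less_numeral_iff semiring_norm(76))
  have "r \<noteq> 1"
  proof
    assume "r = 1"
    then have "(3::real) ^ q = 2 ^ p" by (simp add: r_def)
    then have "(3::nat) ^ q = 2 ^ p" by (metis of_nat_eq_iff of_nat_numeral of_nat_power)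
    moreover have "even ((2::nat) ^ p)" "odd ((3::nat) ^ q)" using h by (auto simp: p_def)
    ultimately show False by metis
  qed
  then consider "r > 1" | "r < 1" by linarith
  then show thesis
  proof cases
    case 1
    \<comment> \<open>Halving brings the start below \<open>a\<close>. The first power of
      \<open>r\<close> that passes \<open>a\<close> gains less than the factor \<open>b / a\<close>
      on its predecessor, so it stays below \<open>b\<close>.\<close>
    obtain M where "t / a < 2 ^ M" using real_arch_pow[of 2 "t / a"] by auto
    then have M: "t / 2 ^ M < a" using ab by (simp add: field_simps)
    define P where "P j \<longleftrightarrow> a < r ^ j * (t / 2 ^ M)" for j
    obtain j where "a / (t / 2 ^ M) < r ^ j" using real_arch_pow[OF 1] by blast
    then have "P j" unfolding P_def using t by (simp add: field_simps)
    define l where "l = (LEAST j. P j)"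
    have "P l" unfolding l_def using \<open>P j\<close> by (rule LeastI)
    moreover have "\<not> P 0" using M by (simp add: P_def)
    ultimately obtain i where i: "l = Suc i" by (metis not0_implies_Suc)
    then have "\<not> P i" using not_less_Least[of i P] unfolding l_def by simp
    then have "r * (r ^ i * (t / 2 ^ M)) \<le> r * a"
      using r0 unfolding P_def not_less by (intro mult_left_mono) auto
    also have "\<dots> < b" using r1 ab by (simp add: field_simps)
    finally have "r ^ l * (t / 2 ^ M) < b" by (simp add: i mult.assoc)
    moreover have "r ^ l * (t / 2 ^ M) = 3 ^ (q * l) * t / 2 ^ (p * l + M)"
      by (simp add: r_def power_divide power_mult power_add)
    ultimately show thesis using that[of "q * l" "p * l + M"] \<open>P l\<close> unfolding P_def by simp
  next
    case 2
    \<comment> \<open>The mirror image: tripling brings the start above \<open>b\<close>, and the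
      first power of \<open>r\<close> that drops below \<open>b\<close> stays above
      \<open>a\<close>.\<close>
    obtain M where "b / t < 3 ^ M" using real_arch_pow[of 3 "b / t"] by auto
    then have M: "b < 3 ^ M * t" using t by (simp add: field_simps)
    define P where "P j \<longleftrightarrow> r ^ j * (3 ^ M * t) < b" for j
    obtain j where "r ^ j < b / (3 ^ M * t)" using real_arch_pow_inv[of "b / (3 ^ M * t)" r] 2 ab t by auto
    then have "P j" unfolding P_def using t by (simp add: field_simps)
    define l where "l = (LEAST j. P j)"
    have "P l" unfolding l_def using \<open>P j\<close> by (rule LeastI)
    moreover have "\<not> P 0" using M by (simp add: P_def)
    ultimately obtain i where i: "l = Suc i" by (metis not0_implies_Suc)
    then have "\<not> P i" using not_less_Least[of i P] unfolding l_def by simp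
    then have "r * b \<le> r * (r ^ i * (3 ^ M * t))"
      using r0 unfolding P_def not_less by (intro mult_left_mono) auto
    moreover have "a < r * b" using r2 ab by (simp add: field_simps)
    ultimately have "a < r ^ l * (3 ^ M * t)" by (simp add: i mult.assoc)
    moreover have "r ^ l * (3 ^ M * t) = 3 ^ (q * l + M) * t / 2 ^ (p * l)"
      by (simp add: r_def power_divide power_mult power_add)
    ultimately show thesis using that[of "q * l + M" "p * l"] \<open>P l\<close> unfolding P_def by simp
  qed
qed

section \<open>Steering heights by digits, and transitivity\<close>

text \<open>A height that has reached 1 stays there under further \<open>True\<close> digits, so
  truncating after each tripling amounts to truncating once at the end.\<close>

lemma fan_map_pow_True:
  "0 \<le> t \<Longrightarrow> t \<le> 1 \<Longrightarrow> (fan_map ^^ n) (fan_point ((case_nat True ^^ n) d) t)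
    = fan_point d (min 1 (3 ^ n * t))"
proof (induction n arbitrary: t)
  case (Suc n)
  have "(3::real) ^ n \<ge> 1" by simp
  then have trunc: "min 1 (3 ^ n * min 1 (3 * t)) = min 1 (3 ^ Suc n * t)"
    using mult_mono[of 1 "3 ^ n" 1 "3 * t"] by (cases "1 \<le> 3 * t") (auto simp: min_def)
  have "(fan_map ^^ Suc n) (fan_point ((case_nat True ^^ Suc n) d) t)
      = (fan_map ^^ n) (fan_map (fan_point (case_nat True ((case_nat True ^^ n) d)) t))"
    by (simp add: funpow_swap1)
  also have "fan_map (fan_point (case_nat True ((case_nat True ^^ n) d)) t)
      = fan_point ((case_nat True ^^ n) d) (min 1 (3 * t))"
    using Suc.prems by (simp add: fan_map_fan_point height_map_def)
  also have "(fan_map ^^ n) \<dots> = fan_point d (min 1 (3 ^ n * min 1 (3 * t)))"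
    using Suc.prems by (intro Suc.IH) auto
  finally show ?case unfolding trunc .
qed simp

lemma fan_map_pow_False:
  "0 \<le> t \<Longrightarrow> (fan_map ^^ n) (fan_point ((case_nat False ^^ n) d) t) = fan_point d (t / 2 ^ n)"
proof (induction n arbitrary: t)
  case (Suc n)
  have "(fan_map ^^ Suc n) (fan_point ((case_nat False ^^ Suc n) d) t)
      = (fan_map ^^ n) (fan_map (fan_point (case_nat False ((case_nat False ^^ n) d)) t))"
    by (simp add: funpow_swap1)
  also have "fan_map (fan_point (case_nat False ((case_nat False ^^ n) d)) t)
      = fan_point ((case_nat False ^^ n) d) (t / 2)"
    using Suc.prems by (simp add: fan_map_fan_point height_map_def)
  also have "(fan_map ^^ n) \<dots> = fan_point d (t / 2 / 2 ^ n)"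
    using Suc.prems by (intro Suc.IH) simp
  finally show ?case by simp
qed simp

text \<open>All halvings come first, then the triplings. During the triplings the height never
  exceeds its final value, which is below 1, so the truncation does not act. The tail
  \<open>d\<close> remains free.\<close>

lemma fan_map_steer:
  assumes "0 < t" "t \<le> 1" "0 < \<alpha>" "\<alpha> < \<beta>" "\<beta> \<le> 1"
  obtains k w s where "\<alpha> < s" "s < \<beta>" "\<And>d. (fan_map ^^ k) (fan_point (w d) t) = fan_point d s"
proof -
  obtain m n where mn: "\<alpha> < 3 ^ n * t / 2 ^ m" "3 ^ n * t / 2 ^ m < \<beta>"
    using powers_3_2_dense assms by metis
  have "t / 2 ^ m \<le> 1"
    using assms(2) by (simp add: field_simps) (meson one_le_numeral one_le_power order_trans)
  moreover have "min 1 (3 ^ n * t / 2 ^ m) = 3 ^ n * t / 2 ^ m" using mn(2) assms(5) by linarith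
  ultimately have "(fan_map ^^ (n + m)) (fan_point ((case_nat False ^^ m) ((case_nat True ^^ n) d)) t)
      = fan_point d (3 ^ n * t / 2 ^ m)" for d
    using assms mn by (simp add: funpow_add fan_map_pow_False fan_map_pow_True)
  with mn that[of _ _ "\<lambda>d. (case_nat False ^^ m) ((case_nat True ^^ n) d)"] show thesis by blast
qed

text \<open>The height after \<open>k\<close> steps depends only on the initial height and the first
  \<open>k\<close> digits, so one \<open>s\<close> serves all continuations.\<close>

lemma fan_map_pow_prefix:
  assumes "0 < t" "t \<le> 1"
  shows "\<exists>s. 0 < s \<and> s \<le> 1 \<and>
    (\<forall>b'. (\<forall>n<k. b' n = b n) \<longrightarrow> (fan_map ^^ k) (fan_point b' t) = fan_point (\<lambda>n. b' (n + k)) s)"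
proof (induction k)
  case 0
  show ?case using assms by auto
next
  case (Suc k)
  then obtain s where s: "0 < s" "s \<le> 1"
    "\<And>b'. (\<forall>n<k. b' n = b n) \<Longrightarrow> (fan_map ^^ k) (fan_point b' t) = fan_point (\<lambda>n. b' (n + k)) s"
    by metis
  have "(fan_map ^^ Suc k) (fan_point b' t) = fan_point (\<lambda>n. b' (n + Suc k)) (height_map (b k) s)"
    if "\<forall>n<Suc k. b' n = b n" for b'
    using s(3)[of b'] s(1) that by (simp add: fan_map_fan_point)
  with height_map_bounds[of s "b k"] s(1,2) show ?case by auto
qed

lemma fan_open_box:
  assumes U: "openin (top_of_set fan) U" "U \<noteq> {}"
  obtains b N \<alpha> \<beta> where "0 < \<alpha>" "\<alpha> < \<beta>" "\<beta> \<le> 1"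
    "\<And>b' t. (\<And>n. n < N \<Longrightarrow> b' n = b n) \<Longrightarrow> \<alpha> < t \<Longrightarrow> t < \<beta> \<Longrightarrow> fan_point b' t \<in> U"
proof -
  obtain T where T: "open T" "U = fan \<inter> T" using U(1) by (auto simp: openin_open)
  obtain p where p: "p \<in> U" using U(2) by blast
  obtain b s where bs: "0 \<le> s" "s \<le> 1" "p = fan_point b s" using p T(2) by (auto elim: fanE)
  let ?F = "\<lambda>x :: real \<times> real. (fst x * snd x, - snd x)"
  have "open (?F -` T)"
    by (rule open_vimage[OF T(1)]) (intro continuous_intros)
  moreover have "(cantor_sum b, s) \<in> ?F -` T" using p T(2) bs(3) by (simp add: fan_point_def)
  ultimately obtain A B where "open A" "open B" "(cantor_sum b, s) \<in> A \<times> B" "A \<times> B \<subseteq> ?F -` T"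
    by (rule open_prod_elim)
  then have AB: "open A" "open B" "cantor_sum b \<in> A" "s \<in> B" "A \<times> B \<subseteq> ?F -` T" by auto
  obtain e where e: "e > 0" "ball (cantor_sum b) e \<subseteq> A" using AB by (metis open_contains_ball)
  obtain e' where e': "e' > 0" "ball s e' \<subseteq> B" using AB by (metis open_contains_ball)
  obtain N where N: "(1 / 3) ^ N < e" using real_arch_pow_inv[OF e(1), of "1 / 3"] by auto
  \<comment> \<open>The inner minimum keeps \<open>\<alpha>\<close> positive even for
    \<open>s = 0\<close>, and still below \<open>\<beta>\<close>.\<close>
  define \<alpha> where "\<alpha> = max (s - e') (min (e' / 2) (1 / 2))"
  define \<beta> where "\<beta> = min 1 (s + e')"
  show thesis
  proof
    show "0 < \<alpha>" "\<alpha> < \<beta>" "\<beta> \<le> 1" using e' bs by (auto simp: \<alpha>_def \<beta>_def)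
    fix b' t assume b': "\<And>n. n < N \<Longrightarrow> b' n = b n" and t: "\<alpha> < t" "t < \<beta>"
    have "\<bar>cantor_sum b' - cantor_sum b\<bar> \<le> 1 / 3 ^ N" by (rule cantor_sum_close) (rule b')
    then have "cantor_sum b' \<in> A" using N e(2) by (auto simp: dist_real_def power_divide abs_minus_commute)
    moreover have "t \<in> B" using t e'(2) by (auto simp: \<alpha>_def \<beta>_def dist_real_def)
    ultimately have "fan_point b' t \<in> T" using AB(5) by (auto simp: fan_point_def)
    moreover have "fan_point b' t \<in> fan"
      using t e'(1) by (intro fan_point_mem) (auto simp: \<alpha>_def \<beta>_def)
    ultimately show "fan_point b' t \<in> U" using T(2) by simp
  qed
qed

lemma transitive_fan_map: "transitive_map fan fan_map"
  unfolding transitive_map_def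
proof (intro allI impI, elim conjE)
  fix U V assume U: "openin (top_of_set fan) U" "U \<noteq> {}" and V: "openin (top_of_set fan) V" "V \<noteq> {}"
  obtain b N \<alpha> \<beta> where B: "0 < \<alpha>" "\<alpha> < \<beta>" "\<beta> \<le> 1"
    "\<And>b' t. (\<And>n. n < N \<Longrightarrow> b' n = b n) \<Longrightarrow> \<alpha> < t \<Longrightarrow> t < \<beta> \<Longrightarrow> fan_point b' t \<in> U"
    using fan_open_box[OF U] by metis
  obtain d \<gamma> \<delta> where D: "0 < \<gamma>" "\<gamma> < \<delta>" "\<delta> \<le> 1" "\<And>t. \<gamma> < t \<Longrightarrow> t < \<delta> \<Longrightarrow> fan_point d t \<in> V"
    using fan_open_box[OF V] by metis
  obtain t where t: "\<alpha> < t" "t < \<beta>" using B(2) dense by blast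
  \<comment> \<open>The first \<open>N\<close> digits keep the point in \<open>U\<close>; the digits
    after them are free for steering.\<close>
  define glue where "glue w = (\<lambda>n. if n < N then b n else w (n - N))" for w
  have glue: "(\<lambda>n. glue w (n + N)) = w" "\<forall>n<N. glue w n = b n" for w by (auto simp: glue_def)
  have t01: "0 < t" "t \<le> 1" using t B by auto
  obtain s where s: "0 < s" "s \<le> 1" "\<And>w. (fan_map ^^ N) (fan_point (glue w) t) = fan_point w s"
    using fan_map_pow_prefix[OF t01, of N b] glue by metis
  obtain k w r where r: "\<gamma> < r" "r < \<delta>" "\<And>d. (fan_map ^^ k) (fan_point (w d) s) = fan_point d r"
    using fan_map_steer[OF s(1,2) D(1-3)] by metis
  have "fan_point (glue (w d)) t \<in> U" by (rule B(4)) (use t in \<open>auto simp: glue_def\<close>)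
  moreover have "(fan_map ^^ (k + N)) (fan_point (glue (w d)) t) = fan_point d r"
    by (simp add: funpow_add s r)
  moreover have "fan_point d r \<in> V" using D(4) r by simp
  ultimately show "\<exists>n. (fan_map ^^ n) ` U \<inter> V \<noteq> {}" by (metis IntI empty_iff imageI)
qed

subsection \<open>The inverse limit is a Lelek fan\<close>

abbreviation fan_limit :: "(nat \<Rightarrow> real \<times> real) set" where
  "fan_limit \<equiv> inverse_limit fan fan_map"

lemma fan_limit_mem: "z \<in> fan_limit \<Longrightarrow> (fan_map ^^ k) (z n) \<in> fan"
  using funpow_mem[OF eq_refl[OF fan_map_image]] inverse_limit_mem by metis

lemma fan_limit_height: "z \<in> fan_limit \<Longrightarrow> 0 \<le> height (z n)" "z \<in> fan_limit \<Longrightarrow> height (z n) \<le> 1"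
  using height_fan inverse_limit_mem by metis+

lemma height_fan_map_eq_0: "p \<in> fan \<Longrightarrow> height (fan_map p) = 0 \<longleftrightarrow> height p = 0"
  using height_fan[of p] by (subst height_fan_map) (auto simp: height_map_def)

lemma height_fan_map_pow_eq_0: "p \<in> fan \<Longrightarrow> height ((fan_map ^^ k) p) = 0 \<longleftrightarrow> height p = 0"
proof (induction k)
  case (Suc k)
  then show ?case
    using height_fan_map_eq_0[OF funpow_mem[OF eq_refl[OF fan_map_image]], of p k] by simp
qed simp

text \<open>Within the fan only the vertex maps to the vertex, so a thread meets it at every index
  or at none.\<close>

lemma fan_limit_height_eq_0:
  assumes z: "z \<in> fan_limit"
  shows "height (z i) = 0 \<longleftrightarrow> height (z j) = 0"
proof -
  have "height (z i) = 0 \<longleftrightarrow> height (z 0) = 0" for i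
    using height_fan_map_pow_eq_0[OF inverse_limit_mem[OF z, of i], of i] inverse_limit_funpow[OF z, of i 0]
    by simp
  then show ?thesis by metis
qed

text \<open>At positive height the successive iterates display the digits of the expansion one by
  one.\<close>

lemma fan_map_digits_inj:
  assumes p: "p \<in> fan" "p' \<in> fan" and h: "height p = height p'"
    and d: "\<And>k. digit ((fan_map ^^ k) p) = digit ((fan_map ^^ k) p')"
  shows "p = p'"
proof -
  obtain b t where bt: "0 \<le> t" "t \<le> 1" "p = fan_point b t" using p(1) by (rule fanE)
  obtain b' t' where bt': "0 \<le> t'" "t' \<le> 1" "p' = fan_point b' t'" using p(2) by (rule fanE)
  have eq: "t' = t" using h bt bt' by simp
  show ?thesis
  proof (cases "t = 0")
    case True
    then show ?thesis using bt bt' eq by simp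
  next
    case False
    then have t: "0 < t" "t \<le> 1" using bt by auto
    have digit: "digit ((fan_map ^^ k) (fan_point b t)) = b k" for b k
    proof -
      obtain s where "0 < s" "(fan_map ^^ k) (fan_point b t) = fan_point (\<lambda>n. b (n + k)) s"
        using fan_map_pow_prefix[OF t, of k b] by blast
      then show ?thesis by simp
    qed
    have "b k = b' k" for k
      using d[of k] digit[of k b] digit[of k b'] unfolding bt(3) bt'(3) eq by simp
    then have "b = b'" by blast
    then show ?thesis using bt bt' eq by simp
  qed
qed

section \<open>Embedding the inverse limit in the fan\<close>

text \<open>No single height would do: because of the truncation at 1, threads with the same digits
  can agree in height at one index and differ further back.\<close>

definition level :: "(nat \<Rightarrow> real \<times> real) \<Rightarrow> real" where
  "level z = (\<Sum>i. height (z i) / 2 ^ Suc i)"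

lemma half_powers: "(\<lambda>i. 1 / 2 ^ Suc i :: real) sums 1"
  using power_half_series by (simp add: power_divide)

lemma level_term_bounds:
  assumes "z \<in> fan_limit"
  shows "0 \<le> height (z i) / 2 ^ Suc i" "height (z i) / 2 ^ Suc i \<le> 1 / 2 ^ Suc i"
  by (intro divide_nonneg_nonneg divide_right_mono fan_limit_height assms; simp)+

lemma summable_level:
  assumes "z \<in> fan_limit"
  shows "summable (\<lambda>i. height (z i) / 2 ^ Suc i)"
proof (rule summable_comparison_test'[OF sums_summable[OF half_powers]])
  show "norm (height (z i) / 2 ^ Suc i) \<le> 1 / 2 ^ Suc i" for i
    using level_term_bounds[OF assms, of i] by (simp only: real_norm_def abs_of_nonneg)
qed

lemma level_bounds:
  assumes "z \<in> fan_limit"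
  shows "0 \<le> level z" "level z \<le> 1"
proof -
  show "0 \<le> level z"
    unfolding level_def by (intro suminf_nonneg summable_level level_term_bounds assms)
  have "level z \<le> (\<Sum>i. 1 / 2 ^ Suc i)"
    unfolding level_def
    by (intro suminf_le summable_level level_term_bounds assms sums_summable[OF half_powers])
  then show "level z \<le> 1" using sums_unique[OF half_powers] by simp
qed

lemma level_mono:
  assumes "z \<in> fan_limit" "z' \<in> fan_limit" "\<And>i. height (z i) \<le> height (z' i)"
  shows "level z \<le> level z'"
  unfolding level_def
  by (intro suminf_le summable_level assms divide_right_mono) simp

lemma level_eq_imp_height_eq:
  assumes z: "z \<in> fan_limit" "z' \<in> fan_limit" and le: "\<And>i. height (z i) \<le> height (z' i)"
    and eq: "level z = level z'"
  shows "height (z i) = height (z' i)"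
proof -
  let ?d = "\<lambda>i. height (z' i) / 2 ^ Suc i - height (z i) / 2 ^ Suc i"
  have "summable ?d" by (intro summable_diff summable_level z)
  moreover have "0 \<le> ?d i" for i using divide_right_mono[OF le[of i], of "2 ^ Suc i"] by simp
  moreover have "(\<Sum>i. ?d i) = 0"
    using suminf_diff[OF summable_level[OF z(2)] summable_level[OF z(1)]] eq by (simp add: level_def)
  ultimately have "?d i = 0" using suminf_eq_zero_iff[of ?d] by blast
  then show ?thesis by simp
qed

lemma level_eq_0:
  assumes "z \<in> fan_limit"
  shows "level z = 0 \<longleftrightarrow> height (z i) = 0"
proof -
  have "level z = 0 \<longleftrightarrow> (\<forall>i. height (z i) / 2 ^ Suc i = 0)"
    unfolding level_def
    by (intro suminf_eq_zero_iff summable_level level_term_bounds assms)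
  also have "\<dots> \<longleftrightarrow> (\<forall>j. height (z j) = 0)" by simp
  also have "\<dots> \<longleftrightarrow> height (z i) = 0" using fan_limit_height_eq_0[OF assms] by blast
  finally show ?thesis .
qed

text \<open>For a fixed digit \<open>height_map\<close> is nondecreasing, so an inequality at a late
  index passes down to earlier ones.\<close>

lemma height_le_descend:
  assumes z: "z \<in> fan_limit" "z' \<in> fan_limit" and d: "\<And>i. digit (z i) = digit (z' i)"
    and le: "height (z (i + k)) \<le> height (z' (i + k))"
  shows "height (z i) \<le> height (z' i)"
  using le
proof (induction k)
  case (Suc k)
  have "height (z j) = height_map (digit (z (Suc j))) (height (z (Suc j)))" if "z \<in> fan_limit" for z j
    using height_fan_map[of "z (Suc j)"] fan_limit_height[OF that] inverse_limit_step[OF that] by simp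
  note step = this[OF z(1), of "i + k"] this[OF z(2), of "i + k"]
  have "height (z (i + k)) \<le> height (z' (i + k))"
    unfolding step d using Suc.prems by (auto simp: height_map_def)
  then show ?case by (rule Suc.IH)
qed simp

text \<open>Strict inequalities in opposite directions at two indices clash once the one at the
  larger index is passed down to the smaller.\<close>

lemma height_comparable:
  assumes z: "z \<in> fan_limit" "z' \<in> fan_limit" and d: "\<And>i. digit (z i) = digit (z' i)"
  shows "(\<forall>i. height (z i) \<le> height (z' i)) \<or> (\<forall>i. height (z' i) \<le> height (z i))"
proof (rule ccontr)
  assume "\<not> ?thesis"
  then obtain i j where ij: "height (z' i) < height (z i)" "height (z j) < height (z' j)"
    by (auto simp: not_le)
  show False
  proof (cases "i \<le> j")
    case True
    then show False using height_le_descend[OF z d, of i "j - i"] ij by simp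
  next
    case False
    then show False using height_le_descend[OF z(2,1) d[symmetric], of j "i - j"] ij by simp
  qed
qed

text \<open>Index \<open>m\<close> encodes a pair \<open>(n, k)\<close>.  The code is redundant, but it determines all digits.\<close>

definition limit_iterate :: "nat \<Rightarrow> (nat \<Rightarrow> real \<times> real) \<Rightarrow> real \<times> real" where
  "limit_iterate m z = (fan_map ^^ snd (prod_decode m)) (z (fst (prod_decode m)))"

definition limit_code :: "(nat \<Rightarrow> real \<times> real) \<Rightarrow> nat \<Rightarrow> bool" where
  "limit_code z m = digit (limit_iterate m z)"

lemma limit_code_eqD:
  assumes "limit_code z = limit_code z'"
  shows "digit ((fan_map ^^ k) (z n)) = digit ((fan_map ^^ k) (z' n))"
  using fun_cong[OF assms, of "prod_encode (n, k)"] by (simp add: limit_code_def limit_iterate_def)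

lemma limit_code_eq_digit: "limit_code z = limit_code z' \<Longrightarrow> digit (z n) = digit (z' n)"
  using limit_code_eqD[of z z' 0 n] by simp

lemma limit_iterate_mem: "z \<in> fan_limit \<Longrightarrow> limit_iterate m z \<in> fan"
  unfolding limit_iterate_def by (rule fan_limit_mem)

lemma continuous_on_limit_iterate: "continuous_on fan_limit (limit_iterate m)"
  unfolding limit_iterate_def[abs_def]
  by (rule continuous_on_compose2[OF continuous_on_funpow_self[OF continuous_on_fan_map] continuous_on_coordinate])
     (auto simp: fan_map_image inverse_limit_mem)

text \<open>A digit can change only across the vertex thread, where the level is 0. This serves both
  the continuity of the embedding and the constancy of the code along arcs that avoid this
  thread.\<close>

lemma limit_iterate_form_eq_0:
  assumes z: "z \<in> fan_limit" and "2 * fst (limit_iterate m z) + snd (limit_iterate m z) = 0"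
  shows "level z = 0"
proof -
  have "height (limit_iterate m z) = 0"
    using digit_form_eq_0[OF limit_iterate_mem[OF z]] assms(2) by blast
  then have "height (z (fst (prod_decode m))) = 0"
    unfolding limit_iterate_def using height_fan_map_pow_eq_0[OF inverse_limit_mem[OF z]] by blast
  then show ?thesis using level_eq_0[OF z] by blast
qed

text \<open>Equal codes make the heights comparable, so equal levels force equal heights; heights
  and digits together determine each coordinate.\<close>

lemma limit_code_level_inj:
  assumes z: "z \<in> fan_limit" "z' \<in> fan_limit" and c: "limit_code z = limit_code z'" and l: "level z = level z'"
  shows "z = z'"
proof
  fix i
  have "height (z j) = height (z' j)" for j
    using height_comparable[OF z limit_code_eq_digit[OF c]]
      level_eq_imp_height_eq[OF z, of j] level_eq_imp_height_eq[OF z(2,1), of j] l by auto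
  then show "z i = z' i"
    using fan_map_digits_inj[OF inverse_limit_mem[OF z(1)] inverse_limit_mem[OF z(2)]] limit_code_eqD[OF c]
    by blast
qed

definition limit_embedding :: "(nat \<Rightarrow> real \<times> real) \<Rightarrow> real \<times> real" where
  "limit_embedding z = fan_point (limit_code z) (level z)"

lemma inj_on_limit_embedding: "inj_on limit_embedding fan_limit"
proof (rule inj_onI)
  fix z z' assume z: "z \<in> fan_limit" "z' \<in> fan_limit" and eq: "limit_embedding z = limit_embedding z'"
  have l: "level z = level z'"
    using arg_cong[OF eq, of snd] by (simp add: limit_embedding_def)
  show "z = z'"
  proof (cases "level z = 0")
    \<comment> \<open>Level 0 hides the code, but only the constant vertex thread has level
      0.\<close>
    case True
    have "w i = (0, 0)" if w: "w \<in> fan_limit" "level w = 0" for w i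
    proof -
      obtain b t where "w i = fan_point b t" using fanE[OF inverse_limit_mem[OF w(1)]] by metis
      moreover have "height (w i) = 0" using level_eq_0[OF w(1)] w(2) by blast
      ultimately show ?thesis by simp
    qed
    then show ?thesis using z l True by (metis ext)
  next
    case False
    have "cantor_sum (limit_code z) * level z = cantor_sum (limit_code z') * level z'"
      using arg_cong[OF eq, of fst] by (simp add: limit_embedding_def fan_point_def)
    then have "cantor_sum (limit_code z) = cantor_sum (limit_code z')" using False l by simp
    then have "limit_code z = limit_code z'" by (intro ext cantor_sum_inj)
    then show ?thesis using limit_code_level_inj z l by blast
  qed
qed

lemma continuous_on_level: "continuous_on fan_limit level"
  unfolding level_def[abs_def]
proof (rule continuous_on_suminf_bounded)
  show "continuous_on fan_limit (\<lambda>z. height (z i) / 2 ^ Suc i)" for i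
    by (intro continuous_intros continuous_on_coordinate) simp
  show "\<bar>height (z i) / 2 ^ Suc i\<bar> \<le> 1 / 2 ^ Suc i" if "z \<in> fan_limit" for i z
    using level_term_bounds[OF that, of i] by (simp only: abs_of_nonneg)
qed (rule sums_summable[OF half_powers])

lemma continuous_on_limit_embedding: "continuous_on fan_limit limit_embedding"
proof -
  let ?q = "\<lambda>m z. 2 * fst (limit_iterate m z) + snd (limit_iterate m z)"
  \<comment> \<open>A digit by itself may jump at the vertex thread. Its product with the level is
    continuous, because the level vanishes wherever the sign form does.\<close>
  let ?g = "\<lambda>m z. (if ?q m z \<le> 0 then 0 else level z) * (2 / 3 ^ Suc m)"
  have "continuous_on fan_limit (\<lambda>z. \<Sum>m. ?g m z)"
  proof (rule continuous_on_suminf_bounded)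
    fix m
    have "continuous_on fan_limit (\<lambda>z. if ?q m z \<le> 0 then 0 else level z)"
    proof (rule continuous_on_cases_le)
      show "continuous_on fan_limit (?q m)"
        by (intro continuous_intros continuous_on_limit_iterate)
      show "continuous_on {z \<in> fan_limit. 0 \<le> ?q m z} level"
        by (rule continuous_on_subset[OF continuous_on_level]) auto
    qed (use limit_iterate_form_eq_0 in auto)
    then show "continuous_on fan_limit (?g m)" by (intro continuous_intros)
  next
    fix m z assume "z \<in> fan_limit"
    from level_bounds[OF this] show "\<bar>?g m z\<bar> \<le> 2 / 3 ^ Suc m" by (auto simp: divide_simps)
  next
    show "summable (\<lambda>m. 2 / 3 ^ Suc m :: real)"
      using summable_cantor_sum[of "\<lambda>n. True"] by simp
  qed
  moreover have "(\<Sum>m. ?g m z) = cantor_sum (limit_code z) * level z" for z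
  proof -
    have "?g m z = (if limit_code z m then 2 else 0) / 3 ^ Suc m * level z" for m
      by (simp add: limit_code_def digit_def)
    then show ?thesis
      unfolding cantor_sum_def by (simp only: suminf_mult2[OF summable_cantor_sum, symmetric])
  qed
  ultimately have "continuous_on fan_limit (\<lambda>z. cantor_sum (limit_code z) * level z)" by simp
  then show ?thesis
    unfolding limit_embedding_def[abs_def] fan_point_def
    by (intro continuous_on_Pair continuous_on_minus continuous_on_level)
qed

lemma continuum_fan_limit: "continuum fan_limit"
  by (rule continuum_inverse_limit[OF continuum_fan continuous_on_fan_map fan_map_image])

lemma fan_limit_homeomorphic_subcontinuum:
  obtains Z where "Z \<subseteq> fan" "continuum Z" "fan_limit homeomorphic Z"
proof
  have Y: "fan_limit \<noteq> {}" "compact fan_limit" "connected fan_limit"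
    using continuum_fan_limit by (auto simp: continuum_def)
  show "limit_embedding ` fan_limit \<subseteq> fan"
    by (auto simp: limit_embedding_def level_bounds fan_point_mem)
  show "continuum (limit_embedding ` fan_limit)"
    using Y continuous_on_limit_embedding
    by (simp add: continuum_def compact_continuous_image connected_continuous_image)
  show "fan_limit homeomorphic limit_embedding ` fan_limit"
    by (rule homeomorphic_compact[OF Y(2) continuous_on_limit_embedding refl inj_on_limit_embedding])
qed

section \<open>End-points of the inverse limit and their density\<close>

lemma connected_nonzero_sign:
  fixes q :: "'a::topological_space \<Rightarrow> real"
  assumes "connected S" "continuous_on S q" "\<And>x. x \<in> S \<Longrightarrow> q x \<noteq> 0" "x \<in> S" "y \<in> S"
  shows "q x > 0 \<longleftrightarrow> q y > 0"
proof -
  have "connected (q ` S)" using assms(1,2) by (rule connected_continuous_image[rotated])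
  then have same: "\<not> (q u > 0 \<and> q v \<le> 0)" if "u \<in> S" "v \<in> S" for u v
    using connectedD_interval[of "q ` S" "q v" "q u" 0] assms(3) that by force
  show ?thesis using same[OF assms(4,5)] same[OF assms(5,4)] by linarith
qed

text \<open>Suppose \<open>e\<close> were interior to an arc. Near \<open>e\<close> the level is
  positive, so the code is constant and the level is injective along the arc. It is then strictly
  monotone there and exceeds \<open>level e\<close> on one side, against maximality.\<close>

lemma end_point_if_top:
  assumes e: "e \<in> fan_limit" "level e > 0"
    and top: "\<And>z. z \<in> fan_limit \<Longrightarrow> limit_code z = limit_code e \<Longrightarrow> level z \<le> level e"
  shows "e \<in> end_points fan_limit"
proof -
  have "e = pathstart g \<or> e = pathfinish g"
    if g: "arc g" "path_image g \<subseteq> fan_limit" "e \<in> path_image g" for g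
  proof (rule ccontr)
    assume ne: "\<not> ?thesis"
    obtain s where s: "s \<in> {0..1}" "g s = e" using g(3) by (auto simp: path_image_def)
    with ne have s01: "0 < s" "s < 1"
      by (auto simp: pathstart_def pathfinish_def order_le_less)
    have cg: "continuous_on {0..1} g" and ig: "inj_on g {0..1}"
      using g(1) by (auto simp: arc_def path_def)
    have gY: "g r \<in> fan_limit" if "r \<in> {0..1}" for r using g(2) that by (auto simp: path_image_def)
    have cl: "continuous_on {0..1} (\<lambda>r. level (g r))"
      by (rule continuous_on_compose2[OF continuous_on_level cg]) (use gY in auto)
    then have "isCont (\<lambda>r. level (g r)) s"
      using s01 by (auto simp: continuous_on_interior interior_atLeastAtMost_real)
    then have "\<forall>\<^sub>F r in at s. level (g r) > 0"
      using order_tendstoD(1)[of _ "level (g s)" "at s" 0] e(2) s(2) by (simp add: isCont_def)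
    then obtain d where d: "d > 0" "\<And>r. r \<noteq> s \<Longrightarrow> dist r s < d \<Longrightarrow> level (g r) > 0"
      by (auto simp: eventually_at)
    \<comment> \<open>Half of \<open>d\<close> keeps the closed interval within the open bound, and
      the other terms keep it inside the parameter interval.\<close>
    define \<delta> where "\<delta> = min (d / 2) (min s (1 - s))"
    let ?I = "{s - \<delta>..s + \<delta>}"
    have \<delta>: "\<delta> > 0" "?I \<subseteq> {0..1}" using d(1) s01 by (auto simp: \<delta>_def)
    have pos: "level (g r) > 0" if "r \<in> ?I" for r
      using that d e(2) s(2) by (cases "r = s") (auto simp: \<delta>_def dist_real_def)
    have limit_code: "limit_code (g r) = limit_code e" if r: "r \<in> ?I" for r
    proof
      fix m
      let ?q = "\<lambda>r. 2 * fst (limit_iterate m (g r)) + snd (limit_iterate m (g r))"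
      have "continuous_on ?I (\<lambda>r. limit_iterate m (g r))"
        by (rule continuous_on_compose2[OF continuous_on_limit_iterate continuous_on_subset[OF cg \<delta>(2)]])
           (use gY \<delta>(2) in auto)
      then have "continuous_on ?I ?q" by (intro continuous_intros)
      moreover have "?q r \<noteq> 0" if "r \<in> ?I" for r
        using limit_iterate_form_eq_0[OF gY, of r m] pos[OF that] \<delta>(2) that by auto
      ultimately have "?q r > 0 \<longleftrightarrow> ?q s > 0"
        using r \<delta>(1) by (intro connected_nonzero_sign[of ?I ?q]) auto
      then show "limit_code (g r) m = limit_code e m" by (simp add: limit_code_def digit_def s(2))
    qed
    have "inj_on (\<lambda>r. level (g r)) ?I"
    proof (rule inj_onI)
      fix r r' assume r: "r \<in> ?I" "r' \<in> ?I" "level (g r) = level (g r')"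
      then have "g r = g r'"
        using limit_code_level_inj[OF gY gY, of r r'] limit_code \<delta>(2) by auto
      then show "r = r'" using ig r \<delta>(2) by (auto dest: inj_onD)
    qed
    then have "level (g s) < level (g (s + \<delta>)) \<or> level (g s) < level (g (s - \<delta>))"
      using continuous_inj_imp_mono[of "s - \<delta>" s "s + \<delta>", OF _ _ continuous_on_subset[OF cl \<delta>(2)]] \<delta>(1) by auto
    moreover have "level (g r) \<le> level (g s)" if "r \<in> ?I" for r
      using top[OF gY limit_code[OF that]] \<delta>(2) that s(2) by auto
    ultimately show False using \<delta>(1) by (simp add: not_le[symmetric])
  qed
  then show ?thesis using e(1) by (simp add: end_points_def)
qed

text \<open>From \<open>m\<close> on, \<open>e\<close> has the greatest possible height; comparison
  with any thread of the same code then descends to the earlier indices.\<close>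

lemma end_point_if_eventually_full:
  assumes e: "e \<in> fan_limit" and full: "\<And>j. height (e (m + j)) = 1"
  shows "e \<in> end_points fan_limit"
proof (rule end_point_if_top[OF e])
  have "level e \<noteq> 0" using level_eq_0[OF e, of m] full[of 0] by simp
  then show "level e > 0" using level_bounds(1)[OF e] by simp
  fix z assume z: "z \<in> fan_limit" "limit_code z = limit_code e"
  show "level z \<le> level e"
  proof (rule level_mono[OF z(1) e])
    fix i
    have "height (z (i + m)) \<le> height (e (i + m))"
      using full[of i] fan_limit_height(2)[OF z(1)] by (simp add: add.commute)
    then show "height (z i) \<le> height (e i)"
      using height_le_descend[OF z(1) e limit_code_eq_digit[OF z(2)]] by blast
  qed
qed

lemma closure_end_points_fan_limit: "closure (end_points fan_limit) = fan_limit"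
proof
  have "closed fan_limit"
    using continuum_fan_limit by (auto simp: continuum_def compact_imp_closed)
  then show "closure (end_points fan_limit) \<subseteq> fan_limit"
    by (intro closure_minimal) (auto simp: end_points_def)
  show "fan_limit \<subseteq> closure (end_points fan_limit)"
  proof
    fix z assume z: "z \<in> fan_limit"
    show "z \<in> closure (end_points fan_limit)"
      unfolding closure_iff_nhds_not_empty
    proof (intro allI impI)
      fix A T :: "(nat \<Rightarrow> real \<times> real) set" assume T: "T \<subseteq> A" "open T" "z \<in> T"
      obtain n W where W: "open W" "z n \<in> W" "\<And>y. y \<in> fan_limit \<Longrightarrow> y n \<in> W \<Longrightarrow> y \<in> T"
        using inverse_limit_basis[OF continuous_on_fan_map eq_refl[OF fan_map_image] z T(2,3)] by metis
      have "openin (top_of_set fan) (fan \<inter> W)" "fan \<inter> W \<noteq> {}"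
        using W(1,2) inverse_limit_mem[OF z, of n] by auto
      then obtain b \<alpha> \<beta> where B: "0 < \<alpha>" "\<alpha> < \<beta>" "\<beta> \<le> 1" "\<And>t. \<alpha> < t \<Longrightarrow> t < \<beta> \<Longrightarrow> fan_point b t \<in> fan \<inter> W"
        using fan_open_box by metis
      obtain k w s where s: "\<alpha> < s" "s < \<beta>" "\<And>d. (fan_map ^^ k) (fan_point (w d) 1) = fan_point d s"
        using fan_map_steer[OF zero_less_one order_refl B(1-3)] by metis
      \<comment> \<open>Height 1 is fixed under the digit \<open>True\<close>, so prepending
        \<open>True\<close> forever gives a backward orbit at height 1. Placed from index
        \<open>n + k\<close> on, it reaches the steered point at index \<open>n\<close>.\<close>
      define p where "p j = fan_point ((case_nat True ^^ j) (w b)) 1" for j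
      have "p j \<in> fan" "fan_map (p (Suc j)) = p j" for j
        by (simp_all add: p_def fan_point_mem fan_map_fan_point height_map_def)
      then obtain e where e: "e \<in> fan_limit" "\<And>j. e (n + k + j) = p j"
        using inverse_limit_extend[OF eq_refl[OF fan_map_image], of p "n + k"] by metis
      have "e n = (fan_map ^^ k) (p 0)" using inverse_limit_funpow[OF e(1), of k n] e(2)[of 0] by simp
      also have "\<dots> = fan_point b s" using s(3) by (simp add: p_def)
      finally have "e \<in> T" using W(3)[OF e(1)] B(4)[OF s(1,2)] by simp
      moreover have "e \<in> end_points fan_limit"
        by (rule end_point_if_eventually_full[OF e(1), of "n + k"]) (simp only: e(2) p_def height_fan_point)
      ultimately show "end_points fan_limit \<inter> A \<noteq> {}" using T(1) by blast
    qed
  qed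
qed

lemma lelek_fan_fan_limit: "lelek_fan fan_limit"
  unfolding lelek_fan_def
  using continuum_fan_limit closure_end_points_fan_limit cantor_fan_fan fan_limit_homeomorphic_subcontinuum
  by metis

theorem theorem1p2:
  shows "\<exists>(X :: (real \<times> real) set) (f :: real \<times> real \<Rightarrow> real \<times> real).
           cantor_fan X \<and>
           f ` X \<subseteq> X \<and> continuous_on X f \<and> transitive_map X f \<and>
           lelek_fan (inverse_limit X f) \<and>
           (\<exists>g. homeomorphism (inverse_limit X f) (inverse_limit X f) shift_map g) \<and>
           transitive_map (inverse_limit X f) shift_map"
proof (intro exI conjI)
  show "cantor_fan fan" by (rule cantor_fan_fan)
  show "fan_map ` fan \<subseteq> fan" using fan_map_image by simp
  then show "homeomorphism fan_limit fan_limit shift_map (\<lambda>x i. fan_map (x i))"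
    by (rule homeomorphism_shift_map[OF continuous_on_fan_map])
  show "continuous_on fan fan_map" by (rule continuous_on_fan_map)
  show "transitive_map fan fan_map" by (rule transitive_fan_map)
  show "lelek_fan fan_limit" by (rule lelek_fan_fan_limit)
  show "transitive_map fan_limit shift_map"
    by (rule transitive_shift_map[OF continuous_on_fan_map fan_map_image transitive_fan_map])
qed

end
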